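(* $\mathsf{FP}\subseteq\#\mathsf{RP}_1\subseteq\#\mathsf{RP}_2\subseteq\#\mathsf{P}$. Also $\mathsf{TotP}\subseteq\#\mathsf{PE}\subseteq\#\mathsf{RP}_2$.
   Context: $\#\mathsf{P}$ is the class of functions $f=acc_M$ counting accepting paths of nondeterministic polynomial-time Turing machines (NPTMs) $M$. $\mathsf{FP}$ is the class of functions in $\#\mathsf{P}$ computable in polynomial time. For $f$, $L_f=\{x: f(x)>0\}$. $\#\mathsf{PE}=\{f\in\#\mathsf{P}: L_f\in\mathsf{P}\}$; $\#\mathsf{RP}_2=\{f\in\#\mathsf{P}: L_f\in\mathsf{RP}\}$. $\mathsf{TotP}=\{tot_M\mid M\text{ an NPTM}\}$, where $tot_M(x)$ is the number of all computation paths of $M$ on $x$ minus $1$. For an NPTM $M$, $p_M$ is the polynomial such that on inputs of length $n$, $M$ makes $p_M(n)$ binary nondeterministic choices; $\mathcal{MR}$ is the set of NPTMs $M$ such that for all $x$ either $acc_M(x)=0$ or $acc_M(x)>\frac12\cdot 2^{p_M(|x|)}$. $\#\mathsf{RP}_1=\{f\in\#\mathsf{P}\mid \exists M\in\mathcal{MR}\ \forall x: f(x)=acc_M(x)\}$.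
   Formalization: In the definition of MR the number of binary choices, the same on all paths, may depend on the input x and not only on |x|; with p_M(|x|) the inclusion FP ⊆ #RP_1 fails, e.g. for an FP function taking values 1 and 3 on inputs of equal length. *)

theory Defs
  imports Complex_Main "HOL-Computational_Algebra.Polynomial"
begin

section \<open>Turing machines\<close>

text \<open>
  Nondeterministic Turing machines with one two-way infinite tape. A machine halts when no
  instruction is applicable, and it accepts when it halts in an accepting state. The states and the
  auxiliary tape symbols are drawn from the natural numbers; each machine uses finitely many.
\<close>

datatype symbol = Blank | Bit bool | Aux nat

datatype move = GoLeft | Stay | GoRight

fun offset :: "move \<Rightarrow> int" where
  "offset GoLeft = -1"
| "offset Stay = 0"
| "offset GoRight = 1"

type_synonym instr = "(nat \<times> symbol) \<times> (nat \<times> symbol \<times> move)"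

record tm =
  states :: "nat set"
  alphabet :: "symbol set"
  start :: nat
  accepting :: "nat set"
  prog :: "instr set"

definition wf_tm :: "tm \<Rightarrow> bool" where
  "wf_tm M \<longleftrightarrow>
     finite (states M) \<and> finite (alphabet M) \<and>
     {Blank, Bit False, Bit True} \<subseteq> alphabet M \<and>
     start M \<in> states M \<and> accepting M \<subseteq> states M \<and>
     prog M \<subseteq> (states M \<times> alphabet M) \<times> (states M \<times> alphabet M \<times> UNIV)"

text \<open>A configuration consists of the state, the tape contents and the head position.\<close>

type_synonym config = "nat \<times> (int \<Rightarrow> symbol) \<times> int"

definition initial :: "tm \<Rightarrow> bool list \<Rightarrow> config" where
  "initial M x =
     (start M, (\<lambda>i. if 0 \<le> i \<and> i < int (length x) then Bit (x ! nat i) else Blank), 0)"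

text \<open>
  Different instructions applicable to a configuration lead to different successors, because they
  differ in the new state, in the contents of the scanned cell or in the new head position. Hence
  computation paths may be identified with sequences of configurations.
\<close>

fun successors :: "tm \<Rightarrow> config \<Rightarrow> config set" where
  "successors M (q, t, h) =
     {(q', t(h := s), h + offset d) | q' s d. ((q, t h), (q', s, d)) \<in> prog M}"

definition partial_paths :: "tm \<Rightarrow> bool list \<Rightarrow> config list set" where
  "partial_paths M x =
     {\<pi>. \<pi> \<noteq> [] \<and> hd \<pi> = initial M x \<and> successively (\<lambda>c d. d \<in> successors M c) \<pi>}"

definition paths :: "tm \<Rightarrow> bool list \<Rightarrow> config list set" where
  "paths M x = {\<pi> \<in> partial_paths M x. successors M (last \<pi>) = {}}"

definition accepting_paths :: "tm \<Rightarrow> bool list \<Rightarrow> config list set" where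
  "accepting_paths M x = {\<pi> \<in> paths M x. fst (last \<pi>) \<in> accepting M}"

definition acc :: "tm \<Rightarrow> bool list \<Rightarrow> nat" where
  "acc M x = card (accepting_paths M x)"

definition tot :: "tm \<Rightarrow> bool list \<Rightarrow> nat" where
  "tot M x = card (paths M x) - 1"

definition poly_time :: "tm \<Rightarrow> bool" where
  "poly_time M \<longleftrightarrow>
     (\<exists>p :: nat poly. \<forall>x. \<forall>\<pi> \<in> partial_paths M x. length \<pi> \<le> poly p (length x))"

text \<open>Nondeterministic choices are binary.\<close>

definition nptm :: "tm \<Rightarrow> bool" where
  "nptm M \<longleftrightarrow> wf_tm M \<and> poly_time M \<and> (\<forall>q s. card {a. ((q, s), a) \<in> prog M} \<le> 2)"

definition dptm :: "tm \<Rightarrow> bool" where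
  "dptm M \<longleftrightarrow> wf_tm M \<and> poly_time M \<and> (\<forall>q s. card {a. ((q, s), a) \<in> prog M} \<le> 1)"

definition num_choices :: "tm \<Rightarrow> config list \<Rightarrow> nat" where
  "num_choices M \<pi> = length (filter (\<lambda>c. card (successors M c) = 2) \<pi>)"


section \<open>Classes of languages\<close>

definition PTIME :: "bool list set set" where
  "PTIME = {L. \<exists>M. dptm M \<and> (\<forall>x. x \<in> L \<longleftrightarrow> accepting_paths M x \<noteq> {})}"

text \<open>
  The probability of acceptance when every binary choice is resolved by an independent fair coin
  toss: a path with \<open>k\<close> choices is followed with probability \<open>1 / 2 ^ k\<close>.
\<close>

definition prob_acc :: "tm \<Rightarrow> bool list \<Rightarrow> real" where
  "prob_acc M x = (\<Sum>\<pi> \<in> accepting_paths M x. (1 / 2) ^ num_choices M \<pi>)"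

definition RP :: "bool list set set" where
  "RP = {L. \<exists>M. nptm M \<and> (\<forall>x. (x \<in> L \<longrightarrow> prob_acc M x \<ge> 1 / 2) \<and>
                              (x \<notin> L \<longrightarrow> prob_acc M x = 0))}"


section \<open>Classes of counting functions\<close>

definition supp_lang :: "(bool list \<Rightarrow> nat) \<Rightarrow> bool list set" where
  "supp_lang f = {x. f x > 0}"

definition sharpP :: "(bool list \<Rightarrow> nat) set" where
  "sharpP = {f. \<exists>M. nptm M \<and> (\<forall>x. f x = acc M x)}"

text \<open>
  The output of a halted machine is the word of bits that starts at the head position and extends
  to the next blank. It is read as a binary numeral with the most significant bit first; leading
  zeros are allowed.
\<close>

fun outputs :: "config \<Rightarrow> bool list \<Rightarrow> bool" where
  "outputs (q, t, h) w \<longleftrightarrow>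
     (\<forall>i < length w. t (h + int i) = Bit (w ! i)) \<and> t (h + int (length w)) = Blank"

definition binary_value :: "bool list \<Rightarrow> nat" where
  "binary_value w = horner_sum of_bool 2 (rev w)"

definition poly_time_computable :: "(bool list \<Rightarrow> nat) \<Rightarrow> bool" where
  "poly_time_computable f \<longleftrightarrow>
     (\<exists>M. dptm M \<and> (\<forall>x. \<forall>\<pi> \<in> paths M x. \<exists>w. outputs (last \<pi>) w \<and> binary_value w = f x))"

definition FP :: "(bool list \<Rightarrow> nat) set" where
  "FP = {f \<in> sharpP. poly_time_computable f}"

definition sharpPE :: "(bool list \<Rightarrow> nat) set" where
  "sharpPE = {f \<in> sharpP. supp_lang f \<in> PTIME}"

definition sharpRP2 :: "(bool list \<Rightarrow> nat) set" where
  "sharpRP2 = {f \<in> sharpP. supp_lang f \<in> RP}"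

definition TotP :: "(bool list \<Rightarrow> nat) set" where
  "TotP = {f. \<exists>M. nptm M \<and> (\<forall>x. f x = tot M x)}"

text \<open>
  Every computation path on input \<open>x\<close> makes exactly \<open>p x\<close> binary choices, so there are \<open>2 ^ p x\<close>
  paths, and \<open>p\<close> is polynomially bounded by the running time. The number of choices may depend on
  the input and not merely on its length: since at most \<open>2 ^ p x\<close> paths accept, a choice count
  determined by the length would prevent a counting function from taking the values 1 and 3 on
  inputs of equal length (0 and 2 choices would be required, respectively), and \<open>FP\<close> would not be
  contained in the class \<open>sharpRP1\<close>.
\<close>

definition MR :: "tm set" where
  "MR = {M. nptm M \<and>
            (\<exists>p :: bool list \<Rightarrow> nat. \<forall>x.
               (\<forall>\<pi> \<in> paths M x. num_choices M \<pi> = p x) \<and>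
               (acc M x = 0 \<or> real (acc M x) > 1 / 2 * 2 ^ p x))}"

definition sharpRP1 :: "(bool list \<Rightarrow> nat) set" where
  "sharpRP1 = {f \<in> sharpP. \<exists>M \<in> MR. \<forall>x. f x = acc M x}"

end

theory Submission
  imports Defs
begin

text \<open>
  Given a machine \<open>M\<close> of \<open>TotP\<close>, accepting on all paths except one distinguished one yields
  \<open>tot M\<close> as a number of accepting paths; and \<open>tot M x\<close> is positive iff some path of \<open>M\<close>
  branches, which a deterministic machine decides by following \<open>M\<close> until its first choice. For a
  function in \<open>FP\<close>, the value \<open>v\<close> is computed first, and then exactly \<open>v\<close> accepting paths are
  generated among the least power of two that is at least \<open>v\<close>, so that more than half of them accept.
\<close>

section \<open>Runs of a finitely branching relation\<close>

text \<open>Path counts must be exact, and \<open>card\<close> of an infinite set is 0, so every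
  count rests on the finiteness that a time bound provides. Counting is done on the run tree of an
  arbitrary successor function, by induction on a bound for its depth; polynomials enter only when
  the machines are assembled. A machine cannot subtract 1 from a count, but a path can know whether
  it is the distinguished one, because the selected path is left at an identifiable step. The case
  of \<open>FP\<close> is the hardest. \<open>MR\<close> wants the same number p of choices on every
  path and 2^p < 2v for a value v > 0. As at most 2^p paths accept, p is forced to be the binary
  logarithm of v rounded up, whatever the leading zeros. Guessing one bit per digit can give too
  many choices, and a path whose fate is decided must still make its remaining choices. The purely
  probabilistic inclusions are easy: paths of a machine in \<open>MR\<close> are equally likely, and
  a deterministic machine accepts with probability 0 or 1.\<close>

definition runs_from :: "('c \<Rightarrow> 'c set) \<Rightarrow> 'c \<Rightarrow> 'c list set" where
  "runs_from S c = {\<pi>. \<pi> \<noteq> [] \<and> hd \<pi> = c \<and> successively (\<lambda>c d. d \<in> S c) \<pi>}"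

definition halting_runs :: "('c \<Rightarrow> 'c set) \<Rightarrow> 'c \<Rightarrow> 'c list set" where
  "halting_runs S c = {\<pi> \<in> runs_from S c. S (last \<pi>) = {}}"

definition depth_le :: "('c \<Rightarrow> 'c set) \<Rightarrow> 'c \<Rightarrow> nat \<Rightarrow> bool" where
  "depth_le S c k \<longleftrightarrow> (\<forall>\<pi> \<in> runs_from S c. length \<pi> \<le> k)"

definition count_runs :: "('c \<Rightarrow> 'c set) \<Rightarrow> ('c \<Rightarrow> bool) \<Rightarrow> 'c \<Rightarrow> nat" where
  "count_runs S A c = card {\<pi> \<in> halting_runs S c. A (last \<pi>)}"

lemma runs_from_rec: "runs_from S c = insert [c] (\<Union>d \<in> S c. (#) c ` runs_from S d)"
proof (intro set_eqI)
  fix \<pi>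
  show "\<pi> \<in> runs_from S c \<longleftrightarrow> \<pi> \<in> insert [c] (\<Union>d \<in> S c. (#) c ` runs_from S d)"
  proof (cases \<pi>)
    case Nil
    then show ?thesis by (auto simp: runs_from_def)
  next
    case (Cons b \<rho>)
    then show ?thesis
      by (cases \<rho>) (auto simp: runs_from_def image_iff)
  qed
qed

lemma halting_runs_leaf: "S c = {} \<Longrightarrow> halting_runs S c = {[c]}"
  by (auto simp: halting_runs_def runs_from_rec[of S c])

lemma halting_runs_step:
  assumes "S c \<noteq> {}"
  shows "halting_runs S c = (\<Union>d \<in> S c. (#) c ` halting_runs S d)"
proof -
  have "\<rho> \<noteq> []" if "\<rho> \<in> runs_from S d" for \<rho> d
    using that by (simp add: runs_from_def)
  with assms show ?thesis
    by (auto simp: halting_runs_def runs_from_rec[of S c] image_iff)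
qed

text \<open>The bound counts configurations, not steps, and a run contains at least its start. This
  makes the base case of every induction on the bound vacuous.\<close>

lemma not_depth_le_0: "\<not> depth_le S c 0"
  unfolding depth_le_def by (subst runs_from_rec) auto

lemma depth_le_Suc: "depth_le S c (Suc k) \<longleftrightarrow> (\<forall>d \<in> S c. depth_le S d k)"
  unfolding depth_le_def by (subst runs_from_rec) auto

lemma finite_halting_runs:
  assumes "depth_le S c k" "\<And>d. finite (S d)"
  shows "finite (halting_runs S c)"
  using assms(1)
proof (induction k arbitrary: c)
  case 0
  then show ?case by (simp add: not_depth_le_0)
next
  case (Suc k)
  then show ?case
    by (cases "S c = {}") (auto simp: halting_runs_leaf halting_runs_step depth_le_Suc assms(2))
qed

lemma count_runs_leaf: "S c = {} \<Longrightarrow> count_runs S A c = of_bool (A c)"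
  by (simp add: count_runs_def halting_runs_leaf Collect_conv_if)

text \<open>Runs from different successors differ in their second configuration once
  \<open>c\<close> is prepended, so the union is disjoint. Finiteness is local here because
  \<open>uniform_tree_sound\<close> has no information on configurations outside the tree.\<close>

lemma count_runs_step:
  assumes "S c \<noteq> {}" "finite (S c)" "\<And>d. d \<in> S c \<Longrightarrow> finite (halting_runs S d)"
  shows "count_runs S A c = (\<Sum>d \<in> S c. count_runs S A d)"
proof -
  let ?R = "\<lambda>d. {\<pi> \<in> halting_runs S d. A (last \<pi>)}"
  have ne: "\<pi> \<noteq> [] \<and> hd \<pi> = d" if "\<pi> \<in> halting_runs S d" for \<pi> d
    using that by (simp add: halting_runs_def runs_from_def)
  have "?R c = (\<Union>d \<in> S c. (#) c ` ?R d)"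
    using ne by (auto simp: halting_runs_step[of S c, OF assms(1)])
  also have "card \<dots> = (\<Sum>d \<in> S c. card ((#) c ` ?R d))"
  proof (rule card_UN_disjoint)
    show "finite (S c)" by fact
    show "\<forall>d \<in> S c. finite ((#) c ` ?R d)"
      using assms(3) by simp
    show "\<forall>d \<in> S c. \<forall>e \<in> S c. d \<noteq> e \<longrightarrow> (#) c ` ?R d \<inter> (#) c ` ?R e = {}"
      using ne by blast
  qed
  also have "\<dots> = (\<Sum>d \<in> S c. card (?R d))"
    by (simp add: card_image)
  finally show ?thesis by (simp add: count_runs_def)
qed

lemma count_runs_rec:
  assumes "depth_le S c k" "\<And>d. finite (S d)" "S c \<noteq> {}"
  shows "count_runs S A c = (\<Sum>d \<in> S c. count_runs S A d)"
proof -
  obtain j where "k = Suc j"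
    using assms(1) by (cases k) (auto simp: not_depth_le_0)
  then have "finite (halting_runs S d)" if "d \<in> S c" for d
    using assms that by (auto simp: depth_le_Suc intro: finite_halting_runs)
  with assms show ?thesis by (intro count_runs_step) auto
qed

text \<open>A tree of finite depth has a leaf. This justifies subtracting 1 in
  \<open>off_path_count\<close> and yields two paths at a branching in
  \<open>branch_tm_runs\<close>.\<close>

lemma count_runs_pos:
  assumes "depth_le S c k" "\<And>d. finite (S d)"
  shows "count_runs S (\<lambda>_. True) c > 0"
  using assms(1)
proof (induction k arbitrary: c)
  case 0
  then show ?case by (simp add: not_depth_le_0)
next
  case (Suc k)
  show ?case
  proof (cases "S c = {}")
    case True
    then show ?thesis by (simp add: count_runs_leaf)
  next
    case False
    moreover have "count_runs S (\<lambda>_. True) d > 0" if "d \<in> S c" for d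
      using Suc that by (simp add: depth_le_Suc)
    ultimately show ?thesis
      using count_runs_rec[OF Suc.prems assms(2) False, of "\<lambda>_. True"] assms(2)
      by (simp add: sum_pos)
  qed
qed

text \<open>
  \<open>uniform_tree S A c a p T\<close>: every run from \<open>c\<close> has at most \<open>T\<close> configurations, every halting
  run makes exactly \<open>p\<close> binary choices, and \<open>a\<close> of the halting runs end in a configuration that
  satisfies \<open>A\<close>.
\<close>

inductive uniform_tree ::
  "('c \<Rightarrow> 'c set) \<Rightarrow> ('c \<Rightarrow> bool) \<Rightarrow> 'c \<Rightarrow> nat \<Rightarrow> nat \<Rightarrow> nat \<Rightarrow> bool" for S A where
  leaf: "S c = {} \<Longrightarrow> uniform_tree S A c (of_bool (A c)) 0 (Suc T)"
| step: "S c = {d} \<Longrightarrow> uniform_tree S A d a p T \<Longrightarrow> uniform_tree S A c a p (Suc T)"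
| fork: "S c = {d, e} \<Longrightarrow> d \<noteq> e \<Longrightarrow> uniform_tree S A d a p T \<Longrightarrow> uniform_tree S A e b p T \<Longrightarrow>
    uniform_tree S A c (a + b) (Suc p) (Suc T)"

text \<open>The rules mirror one level of the recursion for runs, so a derivation certifies running
  time, number of choices and number of accepting paths all at once.\<close>

lemma uniform_tree_sound:
  assumes "uniform_tree S A c a p T"
  shows "finite (halting_runs S c) \<and> depth_le S c T \<and> count_runs S A c = a \<and>
    (\<forall>\<pi> \<in> halting_runs S c. length (filter (\<lambda>c. card (S c) = 2) \<pi>) = p)"
  using assms
proof (induction rule: uniform_tree.induct)
  case (leaf c T)
  then show ?case by (simp add: halting_runs_leaf depth_le_Suc count_runs_leaf)
next
  case (step c d a p T)
  then have "count_runs S A c = (\<Sum>d \<in> S c. count_runs S A d)"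
    by (intro count_runs_step) auto
  with step show ?case by (auto simp: halting_runs_step depth_le_Suc)
next
  case (fork c d e a p T b)
  then have "count_runs S A c = (\<Sum>d \<in> S c. count_runs S A d)"
    by (intro count_runs_step) auto
  with fork show ?case by (auto simp: halting_runs_step depth_le_Suc)
qed


section \<open>Turing machines as branching relations\<close>

lemma partial_paths_eq: "partial_paths M x = runs_from (successors M) (initial M x)"
  by (simp add: partial_paths_def runs_from_def)

lemma paths_eq: "paths M x = halting_runs (successors M) (initial M x)"
  by (simp add: paths_def halting_runs_def partial_paths_eq)

lemma acc_eq: "acc M x = count_runs (successors M) (\<lambda>c. fst c \<in> accepting M) (initial M x)"
  by (simp add: acc_def accepting_paths_def paths_eq count_runs_def)

lemma tot_eq: "tot M x = count_runs (successors M) (\<lambda>_. True) (initial M x) - 1"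
  by (simp add: tot_def paths_eq count_runs_def)

lemma poly_time_eq:
  "poly_time M \<longleftrightarrow>
    (\<exists>p :: nat poly. \<forall>x. depth_le (successors M) (initial M x) (poly p (length x)))"
  by (simp add: poly_time_def partial_paths_eq depth_le_def)

definition instrs :: "tm \<Rightarrow> nat \<times> symbol \<Rightarrow> (nat \<times> symbol \<times> move) set" where
  "instrs M k = {a. (k, a) \<in> prog M}"

fun exec :: "(int \<Rightarrow> symbol) \<Rightarrow> int \<Rightarrow> nat \<times> symbol \<times> move \<Rightarrow> config" where
  "exec t h (q, s, d) = (q, t(h := s), h + offset d)"

text \<open>The scanned cell reveals the written symbol and the displacement reveals the move. Hence
  branching of configurations can be read off the instruction table.\<close>

lemma inj_exec: "inj (exec t h)"
proof (rule injI)
  fix a b assume eq: "exec t h a = exec t h b"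
  obtain q s d q' s' d' where [simp]: "a = (q, s, d)" "b = (q', s', d')"
    by (cases a, cases b)
  from eq have "q = q'" "t(h := s) = t(h := s')" "offset d = offset d'" by auto
  moreover from this have "s = s'" by (metis fun_upd_same)
  moreover have "d = d'" using \<open>offset d = offset d'\<close> by (cases d; cases d') auto
  ultimately show "a = b" by simp
qed

lemma successors_exec: "successors M (q, t, h) = exec t h ` instrs M (q, t h)"
  by (force simp: instrs_def image_iff)

lemma card_successors: "card (successors M (q, t, h)) = card (instrs M (q, t h))"
  by (simp only: successors_exec card_image inj_on_subset[OF inj_exec subset_UNIV])

lemma wf_tm_iff:
  "wf_tm M \<longleftrightarrow> finite (states M) \<and> finite (alphabet M) \<and>
    {Blank, Bit False, Bit True} \<subseteq> alphabet M \<and>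
    start M \<in> states M \<and> accepting M \<subseteq> states M \<and>
    (\<forall>k. \<forall>a \<in> instrs M k. fst k \<in> states M \<and> snd k \<in> alphabet M \<and>
      fst a \<in> states M \<and> fst (snd a) \<in> alphabet M)"
  unfolding wf_tm_def instrs_def subset_iff by (auto simp: mem_Times_iff)

lemma finite_UNIV_move: "finite (UNIV :: move set)"
proof -
  have "(UNIV :: move set) = {GoLeft, Stay, GoRight}"
    using move.exhaust by auto
  then show ?thesis by (metis finite.emptyI finite.insertI)
qed

lemma finite_instrs:
  assumes "wf_tm M"
  shows "finite (instrs M k)"
proof -
  have "instrs M k \<subseteq> states M \<times> alphabet M \<times> UNIV"
    using assms by (auto simp: wf_tm_def instrs_def)
  moreover have "finite (states M \<times> alphabet M \<times> (UNIV :: move set))"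
    using assms by (simp add: wf_tm_def finite_UNIV_move)
  ultimately show ?thesis by (rule finite_subset)
qed

lemma finite_successors: "wf_tm M \<Longrightarrow> finite (successors M c)"
  by (cases c) (simp only: successors_exec finite_imageI finite_instrs)

lemma successors_wf:
  assumes "wf_tm M" "d \<in> successors M c"
  shows "fst c \<in> states M" "fst d \<in> states M"
  using assms by (cases c; force simp: wf_tm_def)+

lemma start_wf: "wf_tm M \<Longrightarrow> fst (initial M x) \<in> states M"
  by (simp add: wf_tm_def initial_def)

lemma nptm_iff: "nptm M \<longleftrightarrow> wf_tm M \<and> poly_time M \<and> (\<forall>k. card (instrs M k) \<le> 2)"
  by (simp add: nptm_def instrs_def)

lemma dptm_iff: "dptm M \<longleftrightarrow> wf_tm M \<and> poly_time M \<and> (\<forall>k. card (instrs M k) \<le> 1)"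
  by (simp add: dptm_def instrs_def)

lemma finite_paths:
  assumes "wf_tm M" "poly_time M"
  shows "finite (paths M x)"
proof -
  obtain k where "depth_le (successors M) (initial M x) k"
    using assms(2) unfolding poly_time_eq by blast
  then show ?thesis
    unfolding paths_eq by (rule finite_halting_runs) (rule finite_successors[OF assms(1)])
qed


section \<open>The inclusions of probabilistic classes\<close>

text \<open>Without binary choices every accepting path has weight 1, so \<open>prob_acc\<close> is
  the number of accepting paths, which is 0 or at least 1.\<close>

lemma PTIME_subset_RP: "PTIME \<subseteq> RP"
proof
  fix L assume "L \<in> PTIME"
  then obtain M where M: "dptm M" and L: "\<And>x. x \<in> L \<longleftrightarrow> accepting_paths M x \<noteq> {}"
    by (auto simp: PTIME_def)
  have card: "card (instrs M k) \<le> 1" for k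
    using M unfolding dptm_iff by blast
  have "card (successors M c) \<noteq> 2" for c
    using card[of "(fst c, fst (snd c) (snd (snd c)))"] by (cases c) (simp only: card_successors, simp)
  then have "prob_acc M x = card (accepting_paths M x)" for x
    by (simp add: prob_acc_def num_choices_def)
  moreover have "finite (accepting_paths M x)" for x
    using M by (simp add: dptm_def accepting_paths_def finite_paths)
  ultimately have "(x \<in> L \<longrightarrow> prob_acc M x \<ge> 1 / 2) \<and> (x \<notin> L \<longrightarrow> prob_acc M x = 0)" for x
    using L[of x] card_gt_0_iff[of "accepting_paths M x"] by auto
  moreover have "nptm M"
    unfolding nptm_iff
  proof (intro conjI allI)
    show "card (instrs M k) \<le> 2" for k
      using card[of k] by simp
  qed (use M in \<open>simp_all add: dptm_iff\<close>)
  ultimately show "L \<in> RP" by (auto simp: RP_def)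
qed

text \<open>All paths have the same weight 1/2^p, which turns the gap in the number of accepting
  paths into a gap in probability.\<close>

lemma MR_prob_acc:
  assumes "M \<in> MR"
  shows "acc M x > 0 \<Longrightarrow> prob_acc M x \<ge> 1 / 2" "acc M x = 0 \<Longrightarrow> prob_acc M x = 0"
proof -
  obtain p where p: "\<And>\<pi>. \<pi> \<in> paths M x \<Longrightarrow> num_choices M \<pi> = p"
    and gap: "acc M x = 0 \<or> real (acc M x) > 1 / 2 * 2 ^ p"
    using assms unfolding MR_def by blast
  have prob: "prob_acc M x = acc M x * (1 / 2) ^ p"
    by (simp add: prob_acc_def acc_def accepting_paths_def p)
  then show "acc M x = 0 \<Longrightarrow> prob_acc M x = 0" by simp
  assume "acc M x > 0"
  with gap have "1 / 2 * 2 ^ p * (1 / 2) ^ p \<le> prob_acc M x"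
    unfolding prob by (intro mult_right_mono) auto
  then show "prob_acc M x \<ge> 1 / 2"
    by (simp add: power_one_over)
qed

lemma sharpRP1_subset_sharpRP2: "sharpRP1 \<subseteq> sharpRP2"
proof
  fix f assume f: "f \<in> sharpRP1"
  then obtain M where M: "M \<in> MR" and eq: "\<And>x. f x = acc M x"
    by (auto simp: sharpRP1_def)
  then have "supp_lang f \<in> RP"
    using M MR_prob_acc[OF M] by (auto simp: RP_def supp_lang_def MR_def intro!: exI[of _ M])
  with f show "f \<in> sharpRP2" by (simp add: sharpRP1_def sharpRP2_def)
qed


section \<open>Counting all paths but one\<close>

text \<open>
  A selected instruction for every situation singles out one computation path. State \<open>q\<close> is
  represented by \<open>2 * q\<close> on the selected path and by \<open>2 * q + 1\<close> once the path has been left.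
\<close>

definition selected :: "tm \<Rightarrow> nat \<times> symbol \<Rightarrow> nat \<times> symbol \<times> move" where
  "selected M k = (SOME a. a \<in> instrs M k)"

definition tag :: "bool \<Rightarrow> nat \<times> 'a \<Rightarrow> nat \<times> 'a" where
  "tag b c = (2 * fst c + of_bool b, snd c)"

text \<open>Halting in any odd state accepts, whatever \<open>M\<close> itself accepts, because
  \<open>tot\<close> counts all paths. The tag never returns to \<open>False\<close>.\<close>

definition off_path_tm :: "tm \<Rightarrow> tm" where
  "off_path_tm M =
    \<lparr>states = (\<lambda>q. 2 * q) ` states M \<union> (\<lambda>q. 2 * q + 1) ` states M,
     alphabet = alphabet M, start = 2 * start M, accepting = (\<lambda>q. 2 * q + 1) ` states M,
     prog = {(tag b k, tag (b \<or> a \<noteq> selected M k) a) | b k a. (k, a) \<in> prog M}\<rparr>"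

lemma tag_eq_iff [simp]: "tag b c = tag b' c' \<longleftrightarrow> b = b' \<and> c = c'"
proof -
  have "2 * q + of_bool b = 2 * q' + of_bool b' \<longleftrightarrow> b = b' \<and> q = q'" for q q' :: nat
    by (cases b; cases b'; simp; presburger)
  then show ?thesis by (auto simp: tag_def prod_eq_iff)
qed

lemma tag_surj: "\<exists>b c. k = tag b c"
proof -
  have "fst k = 2 * (fst k div 2) + of_bool (odd (fst k))" by simp
  then have "k = tag (odd (fst k)) (fst k div 2, snd k)" by (simp add: tag_def)
  then show ?thesis by blast
qed

lemma instrs_off_path:
  "instrs (off_path_tm M) (tag b k) = (\<lambda>a. tag (b \<or> a \<noteq> selected M k) a) ` instrs M k"
proof (intro set_eqI)
  fix a
  have "a \<in> instrs (off_path_tm M) (tag b k) \<longleftrightarrow>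
      (\<exists>b' k' a'. tag b k = tag b' k' \<and> a = tag (b' \<or> a' \<noteq> selected M k') a' \<and> a' \<in> instrs M k')"
    unfolding instrs_def off_path_tm_def by (simp del: split_paired_Ex)
  then show "a \<in> instrs (off_path_tm M) (tag b k) \<longleftrightarrow>
      a \<in> (\<lambda>a. tag (b \<or> a \<noteq> selected M k) a) ` instrs M k"
    by (simp only: tag_eq_iff) blast
qed

lemma exec_tag: "exec t h (tag b a) = tag b (exec t h a)"
  by (cases a) (simp add: tag_def)

lemma successors_tag:
  "successors M (tag b (q, t, h)) = exec t h ` instrs M (tag b (q, t h))"
  unfolding tag_def by (simp only: fst_conv snd_conv successors_exec)

lemma successors_off_path_True:
  "successors (off_path_tm M) (tag True c) = tag True ` successors M c"
proof -
  obtain q t h where c: "c = (q, t, h)" by (cases c)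
  have "instrs (off_path_tm M) (tag True (q, t h)) = tag True ` instrs M (q, t h)"
    by (simp add: instrs_off_path)
  then show ?thesis
    unfolding c successors_tag successors_exec by (simp add: image_image exec_tag)
qed

text \<open>\<open>selected\<close> picks an instruction, while the recursion for counts needs a
  configuration. Injectivity of \<open>exec\<close> makes removing the one the same as removing the
  other, so exactly one successor stays on the selected path.\<close>

lemma successors_off_path_False:
  assumes "successors M c \<noteq> {}"
  shows "\<exists>e \<in> successors M c. successors (off_path_tm M) (tag False c) =
    insert (tag False e) (tag True ` (successors M c - {e}))"
proof -
  obtain q t h where c: "c = (q, t, h)" by (cases c)
  let ?I = "instrs M (q, t h)" and ?a = "selected M (q, t h)"
  have a: "?a \<in> ?I"
    using assms unfolding c successors_exec selected_def by (auto intro: someI)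
  have "instrs (off_path_tm M) (tag False (q, t h)) = insert (tag False ?a) (tag True ` (?I - {?a}))"
    using a by (auto simp: instrs_off_path image_iff)
  then have "successors (off_path_tm M) (tag False c) =
      insert (tag False (exec t h ?a)) (tag True ` exec t h ` (?I - {?a}))"
    unfolding c successors_tag by (simp add: image_image exec_tag)
  also have "exec t h ` (?I - {?a}) = successors M c - {exec t h ?a}"
    unfolding c successors_exec by (simp add: image_set_diff[OF inj_exec])
  finally show ?thesis
    using a unfolding c successors_exec by blast
qed

lemma successors_off_path_empty:
  "successors M c = {} \<Longrightarrow> successors (off_path_tm M) (tag b c) = {}"
  by (cases c) (simp add: successors_tag successors_exec instrs_off_path del: successors.simps)

lemma wf_off_path:
  assumes "wf_tm M"
  shows "wf_tm (off_path_tm M)"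
proof -
  have "fst k \<in> states (off_path_tm M) \<and> snd k \<in> alphabet M \<and>
      fst a \<in> states (off_path_tm M) \<and> fst (snd a) \<in> alphabet M"
    if a: "a \<in> instrs (off_path_tm M) k" for k a
  proof -
    obtain b k' where k: "k = tag b k'" using tag_surj by blast
    with a obtain b' a' where a': "a' \<in> instrs M k'" "a = tag b' a'"
      by (auto simp: instrs_off_path)
    then have "fst k' \<in> states M \<and> snd k' \<in> alphabet M \<and> fst a' \<in> states M \<and>
        fst (snd a') \<in> alphabet M"
      using assms unfolding wf_tm_iff by blast
    then show ?thesis
      unfolding k a' by (cases b; cases b') (auto simp: off_path_tm_def tag_def)
  qed
  with assms show ?thesis
    unfolding wf_tm_iff by (auto simp: off_path_tm_def)
qed

lemma off_path_depth:
  assumes "depth_le (successors M) c k"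
  shows "depth_le (successors (off_path_tm M)) (tag b c) k"
  using assms
proof (induction k arbitrary: b c)
  case 0
  then show ?case by (simp add: not_depth_le_0)
next
  case (Suc k)
  show ?case
  proof (cases "successors M c = {}")
    case True
    then show ?thesis by (simp add: depth_le_Suc successors_off_path_empty)
  next
    case False
    have "depth_le (successors (off_path_tm M)) e k"
      if e: "e \<in> successors (off_path_tm M) (tag b c)" for e
    proof -
      obtain d0 where S': "successors (off_path_tm M) (tag False c) =
          insert (tag False d0) (tag True ` (successors M c - {d0}))" and d0: "d0 \<in> successors M c"
        using successors_off_path_False[OF False] by blast
      have "\<exists>b' d. e = tag b' d \<and> d \<in> successors M c"
      proof (cases b)
        case True
        then show ?thesis using e by (force simp only: successors_off_path_True)
      next
        case False
        then show ?thesis using e d0 by (force simp only: S')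
      qed
      then obtain b' d where "e = tag b' d" "d \<in> successors M c" by blast
      then show ?thesis using Suc.IH[of d b'] Suc.prems by (simp add: depth_le_Suc)
    qed
    then show ?thesis by (simp add: depth_le_Suc)
  qed
qed

text \<open>One successor keeps the tag \<open>False\<close> and loses one path by induction; the
  others have left the selected path and lose none. The condition on the state matters at the
  leaves, since only tagged states of \<open>M\<close> accept.\<close>

lemma off_path_count:
  assumes "wf_tm M" "depth_le (successors M) c k" "fst c \<in> states M"
  shows "count_runs (successors (off_path_tm M)) (\<lambda>c. fst c \<in> accepting (off_path_tm M)) (tag b c) =
    count_runs (successors M) (\<lambda>_. True) c - of_bool (\<not> b)"
  using assms(2,3)
proof (induction k arbitrary: b c)
  case 0
  then show ?case by (simp add: not_depth_le_0)
next
  case (Suc k)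
  let ?S = "successors M" and ?S' = "successors (off_path_tm M)"
  let ?N = "count_runs ?S (\<lambda>_. True)"
  let ?N' = "count_runs ?S' (\<lambda>c. fst c \<in> accepting (off_path_tm M))"
  note fin = finite_successors[OF assms(1)] finite_successors[OF wf_off_path[OF assms(1)]]
  show ?case
  proof (cases "?S c = {}")
    case True
    have "fst (tag b c) \<in> accepting (off_path_tm M) \<longleftrightarrow> b"
      using Suc.prems by (cases b) (auto simp: off_path_tm_def tag_def, presburger)
    with True show ?thesis
      by (simp add: count_runs_leaf successors_off_path_empty)
  next
    case False
    have IH: "?N' (tag b d) = ?N d - of_bool (\<not> b)" if "d \<in> ?S c" for b d
      using Suc that successors_wf(2)[OF assms(1) that] by (simp add: depth_le_Suc)
    have N: "?N c = (\<Sum>d \<in> ?S c. ?N d)"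
      using count_runs_rec[OF Suc.prems(1) fin(1) False] .
    have N': "?N' (tag b c) = (\<Sum>d \<in> ?S' (tag b c). ?N' d)" if "?S' (tag b c) \<noteq> {}"
      using count_runs_rec[OF off_path_depth[OF Suc.prems(1)] fin(2) that] .
    show ?thesis
    proof (cases b)
      case True
      with N' False have "?N' (tag b c) = (\<Sum>d \<in> tag True ` ?S c. ?N' d)"
        by (simp add: successors_off_path_True)
      also have "\<dots> = (\<Sum>d \<in> ?S c. ?N d)"
        by (subst sum.reindex) (auto simp: inj_on_def IH)
      finally show ?thesis using True N by simp
    next
      case b: False
      obtain e where e: "e \<in> ?S c"
        and S': "?S' (tag False c) = insert (tag False e) (tag True ` (?S c - {e}))"
        using successors_off_path_False[OF False] by blast
      \<comment> \<open>Positivity makes the truncated subtraction \<open>?N e - 1\<close>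
        exact.\<close>
      have pos: "?N e > 0"
        using count_runs_pos[of ?S e k] fin(1) Suc.prems(1) e unfolding depth_le_Suc by blast
      have "?N' (tag b c) = ?N' (tag False e) + (\<Sum>d \<in> tag True ` (?S c - {e}). ?N' d)"
        using N' b S' fin(1) by (auto simp: image_iff)
      also have "(\<Sum>d \<in> tag True ` (?S c - {e}). ?N' d) = (\<Sum>d \<in> ?S c - {e}. ?N d)"
        by (subst sum.reindex) (auto simp: inj_on_def IH)
      also have "?N' (tag False e) = ?N e - 1"
        using IH[OF e] by simp
      finally show ?thesis
        using b N pos sum.remove[OF fin(1) e, of ?N] by simp
    qed
  qed
qed

lemma initial_off_path: "initial (off_path_tm M) x = tag False (initial M x)"
  by (simp add: initial_def off_path_tm_def tag_def)

lemma TotP_subset_sharpP: "TotP \<subseteq> sharpP"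
proof
  fix f assume "f \<in> TotP"
  then obtain M where M: "nptm M" and f: "\<And>x. f x = tot M x"
    by (auto simp: TotP_def)
  from M obtain p :: "nat poly"
    where p: "\<And>x. depth_le (successors M) (initial M x) (poly p (length x))"
    by (auto simp: nptm_def poly_time_eq)
  have wf: "wf_tm M" using M by (simp add: nptm_def)
  have "card (instrs (off_path_tm M) k) \<le> 2" for k
  proof -
    obtain b c where k: "k = tag b c" using tag_surj by blast
    have "card (instrs (off_path_tm M) k) \<le> card (instrs M c)"
      unfolding k instrs_off_path by (rule card_image_le[OF finite_instrs[OF wf]])
    with M show ?thesis unfolding nptm_iff using le_trans by blast
  qed
  moreover have "poly_time (off_path_tm M)"
    using off_path_depth[OF p] by (auto simp: poly_time_eq initial_off_path)
  ultimately have "nptm (off_path_tm M)"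
    using wf_off_path[OF wf] by (simp add: nptm_iff)
  moreover have "f x = acc (off_path_tm M) x" for x
    using off_path_count[OF wf p start_wf[OF wf], of False]
    by (simp add: f tot_eq acc_eq initial_off_path)
  ultimately show "f \<in> sharpP" by (auto simp: sharpP_def)
qed


section \<open>Detecting a second path\<close>

text \<open>
  Since every partial path extends to a halting one, there is a second path as soon as a branching
  configuration is reached. State \<open>q\<close> is represented by \<open>Suc q\<close>, and \<open>0\<close> is the accepting state
  entered at the first branching.
\<close>

definition shift :: "nat \<Rightarrow> nat \<times> 'a \<Rightarrow> nat \<times> 'a" where
  "shift n c = (fst c + n, snd c)"

definition branch_tm :: "tm \<Rightarrow> tm" where
  "branch_tm M =
    \<lparr>states = insert 0 (Suc ` states M), alphabet = alphabet M, start = Suc (start M),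
     accepting = {0},
     prog = {(shift (Suc 0) k, shift (Suc 0) a) | k a. instrs M k = {a}} \<union>
            {(shift (Suc 0) k, (0, snd k, Stay)) | k. card (instrs M k) \<ge> 2}\<rparr>"

lemma shift_eq_iff [simp]: "shift n c = shift n c' \<longleftrightarrow> c = c'"
  by (auto simp: shift_def prod_eq_iff)

lemma exec_shift: "exec t h (shift n a) = shift n (exec t h a)"
  by (cases a) (simp add: shift_def)

lemma successors_shift:
  "successors M (shift n (q, t, h)) = exec t h ` instrs M (shift n (q, t h))"
  unfolding shift_def by (simp only: fst_conv snd_conv successors_exec)

lemma instrs_branch:
  "instrs (branch_tm M) (shift (Suc 0) k) =
    (if card (instrs M k) = 1 then shift (Suc 0) ` instrs M k
     else if card (instrs M k) \<ge> 2 then {(0, snd k, Stay)} else {})"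
proof -
  have "a \<in> instrs (branch_tm M) (shift (Suc 0) k) \<longleftrightarrow>
      (\<exists>b. a = shift (Suc 0) b \<and> instrs M k = {b}) \<or> a = (0, snd k, Stay) \<and> card (instrs M k) \<ge> 2" for a
    unfolding instrs_def[of "branch_tm M"] unfolding branch_tm_def
    by (simp del: split_paired_Ex)
  then have "instrs (branch_tm M) (shift (Suc 0) k) =
      {a. (\<exists>b. a = shift (Suc 0) b \<and> instrs M k = {b}) \<or>
        a = (0, snd k, Stay) \<and> card (instrs M k) \<ge> 2}"
    by blast
  then show ?thesis
    by (auto simp: card_1_singleton_iff simp del: split_paired_Ex split_paired_All)
qed

lemma instrs_branch_0: "instrs (branch_tm M) (0, s) = {}"
  unfolding instrs_def[of "branch_tm M"] unfolding branch_tm_def shift_def by simp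

lemma successors_branch:
  "successors (branch_tm M) (shift (Suc 0) c) =
    (if card (successors M c) = 1 then shift (Suc 0) ` successors M c
     else if card (successors M c) \<ge> 2 then {(0, snd c)} else {})"
proof -
  obtain q t h where c: "c = (q, t, h)" by (cases c)
  show ?thesis
    unfolding c successors_shift card_successors instrs_branch
    by (simp add: successors_exec image_image exec_shift del: successors.simps)
qed

lemma successors_branch_0: "successors (branch_tm M) (0, r) = {}"
  by (cases r) (simp add: successors_exec instrs_branch_0 del: successors.simps)

lemma instrs_branch_cases:
  obtains k' where "k = shift (Suc 0) k'" | "instrs (branch_tm M) k = {}"
proof (cases "fst k")
  case 0
  then show ?thesis using that(2) instrs_branch_0[of M "snd k"] by (cases k) simp
next
  case (Suc q)
  then have "k = shift (Suc 0) (q, snd k)" by (simp add: shift_def prod_eq_iff)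
  then show ?thesis by (rule that(1))
qed

lemma wf_branch:
  assumes "wf_tm M"
  shows "wf_tm (branch_tm M)"
proof -
  have "fst k \<in> states (branch_tm M) \<and> snd k \<in> alphabet M \<and>
      fst a \<in> states (branch_tm M) \<and> fst (snd a) \<in> alphabet M"
    if a: "a \<in> instrs (branch_tm M) k" for k a
  proof -
    obtain k' where k: "k = shift (Suc 0) k'"
      using a by (cases rule: instrs_branch_cases[where k = k and M = M]) auto
    have k': "fst k' \<in> states M" "snd k' \<in> alphabet M" if "instrs M k' \<noteq> {}"
      using assms that unfolding wf_tm_iff by blast+
    from a consider a' where "a' \<in> instrs M k'" "a = shift (Suc 0) a'"
      | "instrs M k' \<noteq> {}" "a = (0, snd k', Stay)"
      unfolding k instrs_branch by (fastforce split: if_splits)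
    then show ?thesis
    proof cases
      case 1
      moreover from this have "fst a' \<in> states M" "fst (snd a') \<in> alphabet M"
        using assms unfolding wf_tm_iff by blast+
      ultimately show ?thesis
        using k' by (auto simp: k branch_tm_def shift_def)
    next
      case 2
      with k' show ?thesis by (auto simp: k branch_tm_def shift_def)
    qed
  qed
  with assms show ?thesis
    unfolding wf_tm_iff by (auto simp: branch_tm_def)
qed

text \<open>A single successor passes both counts on unchanged. At a branching the new machine has
  one accepting path, and \<open>M\<close> has at least two paths since each successor contributes
  one. At a leaf \<open>M\<close> has one path and the new machine rejects.\<close>

lemma branch_tm_runs:
  assumes "wf_tm M" "depth_le (successors M) c k"
  shows "depth_le (successors (branch_tm M)) (shift (Suc 0) c) k \<and>
    (count_runs (successors (branch_tm M)) (\<lambda>c. fst c \<in> accepting (branch_tm M)) (shift (Suc 0) c) > 0 \<longleftrightarrow>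
     count_runs (successors M) (\<lambda>_. True) c > 1)"
  using assms(2)
proof (induction k arbitrary: c)
  case 0
  then show ?case by (simp add: not_depth_le_0)
next
  case (Suc k)
  let ?S = "successors M" and ?S' = "successors (branch_tm M)"
  let ?N = "count_runs ?S (\<lambda>_. True)"
  let ?A' = "\<lambda>c. fst c \<in> accepting (branch_tm M)"
  let ?N' = "count_runs ?S' ?A'"
  note fin = finite_successors[OF assms(1)] finite_successors[OF wf_branch[OF assms(1)]]
  have N: "?N c = (\<Sum>d \<in> ?S c. ?N d)" if "?S c \<noteq> {}"
    using count_runs_rec[OF Suc.prems fin(1) that] .
  have acc: "?A' (shift (Suc 0) c) \<longleftrightarrow> False" "?A' (0, snd c)"
    by (auto simp: branch_tm_def shift_def)
  consider "?S c = {}" | "card (?S c) = 1" | "card (?S c) \<ge> 2"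
    using fin(1)[of c] by (metis One_nat_def Suc_leI card_gt_0_iff le_neq_implies_less numeral_2_eq_2)
  then show ?case
  proof cases
    case 1
    then show ?thesis
      using acc successors_branch[of M c] by (simp add: depth_le_Suc count_runs_leaf)
  next
    case 2
    then obtain d where d: "?S c = {d}" by (auto simp: card_1_singleton_iff)
    then have S': "?S' (shift (Suc 0) c) = {shift (Suc 0) d}" by (simp add: successors_branch)
    have depth: "depth_le ?S d k" using Suc.prems d by (simp add: depth_le_Suc)
    have "depth_le ?S' (shift (Suc 0) c) (Suc k)"
      using Suc.IH[OF depth] S' by (simp add: depth_le_Suc)
    moreover from count_runs_rec[OF this fin(2)] have "?N' (shift (Suc 0) c) = ?N' (shift (Suc 0) d)"
      using S' by simp
    ultimately show ?thesis
      using Suc.IH[OF depth] N d by simp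
  next
    case 3
    then have S': "?S' (shift (Suc 0) c) = {(0, snd c)}" by (simp add: successors_branch)
    obtain d where "d \<in> ?S c" using 3 by (cases "?S c = {}") auto
    \<comment> \<open>The configuration in state 0 takes the place of a successor of
      \<open>M\<close>, so it fits into the same depth bound.\<close>
    then have "k \<noteq> 0" using Suc.prems unfolding depth_le_Suc by (metis not_depth_le_0)
    then have "depth_le ?S' (0, snd c) k"
      by (cases k) (simp_all add: depth_le_Suc successors_branch_0)
    then have depth: "depth_le ?S' (shift (Suc 0) c) (Suc k)" using S' by (simp add: depth_le_Suc)
    have "?N' (shift (Suc 0) c) = ?N' (0, snd c)"
      using count_runs_rec[OF depth fin(2)] S' by simp
    also have "\<dots> = 1" using acc by (simp add: count_runs_leaf successors_branch_0)
    finally have "?N' (shift (Suc 0) c) = 1" .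
    moreover have "?N d \<ge> 1" if "d \<in> ?S c" for d
      using count_runs_pos[of ?S d k] fin(1) Suc.prems that
      unfolding depth_le_Suc by (simp add: Suc_le_eq)
    then have "?N c \<ge> card (?S c)"
      using sum_bounded_below[of "?S c" 1 ?N] N 3 by fastforce
    ultimately show ?thesis using depth 3 by simp
  qed
qed

lemma initial_branch: "initial (branch_tm M) x = shift (Suc 0) (initial M x)"
  by (simp add: initial_def branch_tm_def shift_def)

lemma TotP_subset_sharpPE: "TotP \<subseteq> sharpPE"
proof
  fix f assume f: "f \<in> TotP"
  then obtain M where M: "nptm M" and tot: "\<And>x. f x = tot M x"
    by (auto simp: TotP_def)
  from M obtain p :: "nat poly"
    where p: "\<And>x. depth_le (successors M) (initial M x) (poly p (length x))"
    by (auto simp: nptm_def poly_time_eq)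
  have wf: "wf_tm M" using M by (simp add: nptm_def)
  have "card (instrs (branch_tm M) k) \<le> 1" for k
  proof (cases rule: instrs_branch_cases[where k = k and M = M])
    case (1 k')
    then show ?thesis
      using card_image_le[OF finite_instrs[OF wf], of "shift (Suc 0)" k'] by (simp add: instrs_branch)
  qed simp
  moreover have "poly_time (branch_tm M)"
    using branch_tm_runs[OF wf p] by (auto simp: poly_time_eq initial_branch)
  ultimately have "dptm (branch_tm M)"
    using wf_branch[OF wf] by (simp add: dptm_iff)
  moreover have "x \<in> supp_lang f \<longleftrightarrow> accepting_paths (branch_tm M) x \<noteq> {}" for x
  proof -
    have "finite (accepting_paths (branch_tm M) x)"
      using \<open>dptm (branch_tm M)\<close> by (simp add: dptm_def accepting_paths_def finite_paths)
    then have "accepting_paths (branch_tm M) x \<noteq> {} \<longleftrightarrow> acc (branch_tm M) x > 0"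
      by (simp add: acc_def card_gt_0_iff)
    also have "\<dots> \<longleftrightarrow> tot M x > 0"
      using branch_tm_runs[OF wf p] by (simp add: acc_eq tot_eq initial_branch)
    finally show ?thesis by (simp add: supp_lang_def tot)
  qed
  ultimately have "supp_lang f \<in> PTIME" by (auto simp: PTIME_def)
  with f show "f \<in> sharpPE" using TotP_subset_sharpP by (auto simp: sharpPE_def)
qed


section \<open>Generating paths from a binary numeral\<close>

lemma uniform_tree_mono:
  assumes "uniform_tree S A c a p T" "T \<le> T'"
  shows "uniform_tree S A c a p T'"
  using assms
proof (induction arbitrary: T' rule: uniform_tree.induct)
  case (leaf c T)
  then obtain n where "T' = Suc n" by (auto dest: Suc_le_D)
  then show ?case using uniform_tree.leaf[of S c A n, OF leaf.hyps] by (simp only:)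
next
  case (step c d a p T)
  then obtain n where "T' = Suc n" "T \<le> n" by (auto dest: Suc_le_D)
  then show ?case using step by (auto intro: uniform_tree.step)
next
  case (fork c d e a p T b)
  then obtain n where "T' = Suc n" "T \<le> n" by (auto dest: Suc_le_D)
  then show ?case using fork by (auto intro: uniform_tree.fork)
qed

lemma uniform_tree_leaf_exec:
  "instrs M (q, t h) = {} \<Longrightarrow> uniform_tree (successors M) A (q, t, h) (of_bool (A (q, t, h))) 0 (Suc T)"
  by (rule uniform_tree.leaf) (simp only: successors_exec image_empty)

lemma uniform_tree_step_exec:
  "instrs M (q, t h) = {i} \<Longrightarrow> uniform_tree (successors M) A (exec t h i) a p T \<Longrightarrow>
    uniform_tree (successors M) A (q, t, h) a p (Suc T)"
  by (rule uniform_tree.step) (simp only: successors_exec image_empty image_insert)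

lemma uniform_tree_fork_exec:
  "instrs M (q, t h) = {i, j} \<Longrightarrow> i \<noteq> j \<Longrightarrow> uniform_tree (successors M) A (exec t h i) a p T \<Longrightarrow>
    uniform_tree (successors M) A (exec t h j) b p T \<Longrightarrow>
    uniform_tree (successors M) A (q, t, h) (a + b) (Suc p) (Suc T)"
  by (rule uniform_tree.fork) (auto simp only: successors_exec image_empty image_insert dest: injD[OF inj_exec])

section \<open>Numerals on the tape\<close>

text \<open>The recursive form of \<open>outputs\<close>, suited to induction along one pass of the
  head from left to right.\<close>

fun reads :: "(int \<Rightarrow> symbol) \<Rightarrow> int \<Rightarrow> bool list \<Rightarrow> bool" where
  "reads t h [] \<longleftrightarrow> t h = Blank"
| "reads t h (b # w) \<longleftrightarrow> t h = Bit b \<and> reads t (h + 1) w"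

lemma outputs_reads: "outputs (q, t, h) w \<longleftrightarrow> reads t h w"
proof (induction w arbitrary: h)
  case (Cons b w)
  have "outputs (q, t, h) (b # w) \<longleftrightarrow> t h = Bit b \<and> outputs (q, t, h + 1) w"
    by (auto simp: All_less_Suc2 algebra_simps)
  with Cons show ?case by simp
qed simp

text \<open>Cells behind the head do not affect the unread word. The counter may therefore write
  different bits there to make two choices with the same next state lead to distinct
  configurations.\<close>

lemma reads_upd: "k < h \<Longrightarrow> reads (t(k := s)) h w \<longleftrightarrow> reads t h w"
  by (induction w arbitrary: h) auto

text \<open>The output occupies distinct nonblank cells, and a step fills at most one new cell; this
  is how the running time of \<open>M\<close> limits the length of its numeral.\<close>

lemma reads_length_le:
  assumes "reads t h w" "finite {i. t i \<noteq> Blank}"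
  shows "length w \<le> card {i. t i \<noteq> Blank}"
proof -
  have "outputs (undefined, t, h) w" using assms(1) by (simp only: outputs_reads)
  then have "(\<lambda>i. h + int i) ` {..<length w} \<subseteq> {i. t i \<noteq> Blank}" by auto
  with assms(2) have "card ((\<lambda>i. h + int i) ` {..<length w}) \<le> card {i. t i \<noteq> Blank}"
    by (rule card_mono)
  then show ?thesis by (simp add: card_image inj_on_def)
qed

lemma binary_value_Nil: "binary_value [] = 0"
  by (simp add: binary_value_def)

lemma binary_value_Cons: "binary_value (b # w) = of_bool b * 2 ^ length w + binary_value w"
  by (simp add: binary_value_def horner_sum_append)

text \<open>
  A numeral of value \<open>v > 0\<close> is to be turned into \<open>v\<close> accepting paths out of \<open>2 ^ p < 2 * v\<close>, so a
  power of two needs one choice less than the other numerals of the same length. The machine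
  passes once over the numeral, from left to right, and postpones that choice until the second
  digit 1 is met. With the word \<open>w\<close> still to be read, the numbers of accepting paths from the
  states 0, ..., 5 are: \<open>v\<close> (0, skipping leading zeros), \<open>2 ^ length w + v\<close> (1, the path encoding
  the prefix 10...0), \<open>2 ^ length w\<close> (2, the other paths before the second digit 1), all (3), none
  (4), and \<open>v\<close> (5, comparing a guessed word with \<open>w\<close>), where \<open>v = binary_value w\<close>.
\<close>

definition counter :: "nat \<Rightarrow> bool \<Rightarrow> (nat \<times> symbol \<times> move) set" where
  "counter q b =
    (if q = 0 then {(of_bool b, Bit b, GoRight)}
     else if q = 1 then
       (if b then {(3, Bit True, Stay), (5, Bit True, Stay)}
        else {(1, Bit False, GoRight), (2, Bit False, GoRight)})
     else if q = 2 then
       (if b then {(3, Bit True, Stay), (4, Bit True, Stay)}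
        else {(2, Bit False, GoRight), (2, Bit True, GoRight)})
     else if q = 3 \<or> q = 4 then {(q, Bit False, GoRight), (q, Bit True, GoRight)}
     else if q = 5 then
       (if b then {(3, Bit True, GoRight), (5, Bit True, GoRight)}
        else {(5, Bit False, GoRight), (4, Bit False, GoRight)})
     else {})"

text \<open>States 1, 2 and 3 are those whose count is 1 when nothing is left to read. A halting
  \<open>M\<close> hands over to state 0 by rewriting the scanned symbol in place, so tape and head
  survive; restricting this to \<open>states M\<close> and \<open>alphabet M\<close> keeps the
  program finite.\<close>

definition counter_tm :: "tm \<Rightarrow> tm" where
  "counter_tm M =
    \<lparr>states = {..<6} \<union> (\<lambda>q. q + 6) ` states M, alphabet = alphabet M, start = start M + 6,
     accepting = {1, 2, 3},
     prog = {((q, Bit b), a) | q b a. a \<in> counter q b} \<union>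
            {(shift 6 k, shift 6 a) | k a. a \<in> instrs M k} \<union>
            {(shift 6 k, (0, snd k, Stay)) | k.
               fst k \<in> states M \<and> snd k \<in> alphabet M \<and> instrs M k = {}}\<rparr>"

lemma instrs_counter_tm:
  "a \<in> instrs (counter_tm M) k \<longleftrightarrow>
    (\<exists>b. snd k = Bit b \<and> a \<in> counter (fst k) b) \<or>
    (\<exists>k' a'. k = shift 6 k' \<and> a = shift 6 a' \<and> a' \<in> instrs M k') \<or>
    (\<exists>k'. k = shift 6 k' \<and> a = (0, snd k', Stay) \<and>
      fst k' \<in> states M \<and> snd k' \<in> alphabet M \<and> instrs M k' = {})"
proof -
  have "a \<in> instrs (counter_tm M) k \<longleftrightarrow>
      (\<exists>q b. k = (q, Bit b) \<and> a \<in> counter q b) \<or>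
      (\<exists>k' a'. k = shift 6 k' \<and> a = shift 6 a' \<and> a' \<in> instrs M k') \<or>
      (\<exists>k'. k = shift 6 k' \<and> a = (0, snd k', Stay) \<and>
        fst k' \<in> states M \<and> snd k' \<in> alphabet M \<and> instrs M k' = {})"
    unfolding instrs_def[of "counter_tm M"] unfolding counter_tm_def
    by (simp only: tm.simps mem_Collect_eq Un_iff prod.inject) blast
  also have "(\<exists>q b. k = (q, Bit b) \<and> a \<in> counter q b) \<longleftrightarrow>
      (\<exists>b. snd k = Bit b \<and> a \<in> counter (fst k) b)"
    by (cases k) auto
  finally show ?thesis .
qed

lemma less_6_neq_shift: "q < 6 \<Longrightarrow> (q, s) \<noteq> shift 6 k"
  by (simp add: shift_def)

lemma instrs_counter_Bit: "q < 6 \<Longrightarrow> instrs (counter_tm M) (q, Bit b) = counter q b"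
  by (intro set_eqI) (simp add: instrs_counter_tm less_6_neq_shift del: split_paired_Ex)

lemma instrs_counter_Blank: "q < 6 \<Longrightarrow> instrs (counter_tm M) (q, Blank) = {}"
  by (intro equals0I) (simp add: instrs_counter_tm less_6_neq_shift del: split_paired_Ex)

lemma instrs_counter_shift:
  "instrs (counter_tm M) (shift 6 k) = (if instrs M k \<noteq> {} then shift 6 ` instrs M k
    else if fst k \<in> states M \<and> snd k \<in> alphabet M then {(0, snd k, Stay)} else {})"
proof -
  have "counter (fst (shift 6 k)) b = {}" for b
    by (simp add: counter_def shift_def)
  then have "instrs (counter_tm M) (shift 6 k) = {a. (\<exists>a'. a = shift 6 a' \<and> a' \<in> instrs M k) \<or>
      a = (0, snd k, Stay) \<and> fst k \<in> states M \<and> snd k \<in> alphabet M \<and> instrs M k = {}}"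
    by (intro set_eqI) (auto simp: instrs_counter_tm simp del: split_paired_Ex)
  then show ?thesis by auto
qed

section \<open>Path counts from the counter states\<close>

abbreviation counter_tree :: "tm \<Rightarrow> config \<Rightarrow> nat \<Rightarrow> nat \<Rightarrow> nat \<Rightarrow> bool" where
  "counter_tree M \<equiv>
    uniform_tree (successors (counter_tm M)) (\<lambda>c. fst c \<in> accepting (counter_tm M))"

lemma counter_leaf:
  assumes "reads t h []" "q < 6"
  shows "counter_tree M (q, t, h) (of_bool (q \<in> {1, 2, 3})) 0 (Suc T)"
proof -
  have "instrs (counter_tm M) (q, t h) = {}" using assms by (simp add: instrs_counter_Blank)
  then show ?thesis
    using uniform_tree_leaf_exec[of "counter_tm M" q t h "\<lambda>c. fst c \<in> accepting (counter_tm M)" T]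
    by (simp add: counter_tm_def)
qed

text \<open>The fate of these paths is decided, but they go on choosing once per digit so that all
  paths make equally many choices.\<close>

lemma counter_const:
  assumes "reads t h w" "q = 3 \<or> q = 4"
  shows "counter_tree M (q, t, h) (of_bool (q = 3) * 2 ^ length w) (length w) (Suc (length w))"
  using assms(1)
proof (induction w arbitrary: t h)
  case Nil
  from counter_leaf[OF this, of q M 0] assms(2) show ?case by auto
next
  case (Cons b w)
  have r: "reads (t(h := s)) (h + 1) w" for s
    using Cons.prems by (simp add: reads_upd)
  have "instrs (counter_tm M) (q, t h) = {(q, Bit False, GoRight), (q, Bit True, GoRight)}"
    using Cons.prems assms(2) by (auto simp: instrs_counter_Bit counter_def)
  moreover have "counter_tree M (exec t h (q, Bit c, GoRight))
      (of_bool (q = 3) * 2 ^ length w) (length w) (Suc (length w))" for c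
    unfolding exec.simps offset.simps by (rule Cons.IH[OF r])
  ultimately have "counter_tree M (q, t, h)
      (of_bool (q = 3) * 2 ^ length w + of_bool (q = 3) * 2 ^ length w)
      (Suc (length w)) (Suc (Suc (length w)))"
    by (intro uniform_tree_fork_exec) auto
  then show ?case by (simp add: mult_2 distrib_left)
qed

lemmas counter_all = counter_const[where q = 3, simplified]
lemmas counter_none = counter_const[where q = 4, simplified]

text \<open>The guessed word is to be smaller than \<open>w\<close>: a digit 1 is undercut (state 3)
  or matched, a digit 0 is matched or exceeded (state 4). Equality at the end rejects, and exactly
  \<open>binary_value w\<close> words of this length are smaller.\<close>

lemma counter_compare:
  assumes "reads t h w"
  shows "counter_tree M (5, t, h) (binary_value w) (length w) (Suc (length w))"
  using assms
proof (induction w arbitrary: t h)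
  case Nil
  from counter_leaf[OF this, of 5 M 0] show ?case by (simp add: binary_value_Nil)
next
  case (Cons b w)
  have r: "reads (t(h := s)) (h + 1) w" for s
    using Cons.prems by (simp add: reads_upd)
  have IH: "counter_tree M (5, t(h := s), h + 1) (binary_value w) (length w) (Suc (length w))" for s
    by (rule Cons.IH[OF r])
  show ?case
  proof (cases b)
    case True
    have "instrs (counter_tm M) (5, t h) = {(3, Bit True, GoRight), (5, Bit True, GoRight)}"
      using Cons.prems True by (simp add: instrs_counter_Bit counter_def)
    then have "counter_tree M (5, t, h) (2 ^ length w + binary_value w)
        (Suc (length w)) (Suc (Suc (length w)))"
      using counter_all[OF r] IH by (intro uniform_tree_fork_exec) auto
    with True show ?thesis by (simp add: binary_value_Cons)
  next
    case False
    have "instrs (counter_tm M) (5, t h) = {(5, Bit False, GoRight), (4, Bit False, GoRight)}"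
      using Cons.prems False by (simp add: instrs_counter_Bit counter_def)
    then have "counter_tree M (5, t, h) (binary_value w + 0)
        (Suc (length w)) (Suc (Suc (length w)))"
      using counter_none[OF r] IH by (intro uniform_tree_fork_exec) auto
    with False show ?thesis by (simp add: binary_value_Cons)
  qed
qed

text \<open>Each digit 0 doubles the paths. The postponed choice occurs only if another 1 follows,
  hence the \<open>of_bool\<close> term; it adds a rejecting half and leaves the number of accepting
  paths unchanged.\<close>

lemma counter_other:
  assumes "reads t h w"
  shows "counter_tree M (2, t, h) (2 ^ length w) (length w + of_bool (binary_value w > 0))
    (Suc (Suc (length w)))"
  using assms
proof (induction w arbitrary: t h)
  case Nil
  from counter_leaf[OF this, of 2 M 1] show ?case by (simp add: binary_value_Nil)
next
  case (Cons b w)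
  show ?case
  proof (cases b)
    case True
    have "instrs (counter_tm M) (2, t h) = {(3, Bit True, Stay), (4, Bit True, Stay)}"
      using Cons.prems True by (simp add: instrs_counter_Bit counter_def)
    \<comment> \<open>Writing the digit back without moving lets the next state read it again, so
      this choice is an extra one.\<close>
    moreover have "t(h := Bit True) = t"
      using Cons.prems True by (intro fun_upd_idem) simp
    ultimately have "counter_tree M (2, t, h) (2 ^ length (b # w) + 0)
        (Suc (length (b # w))) (Suc (Suc (length (b # w))))"
      using counter_all[OF Cons.prems] counter_none[OF Cons.prems]
      by (intro uniform_tree_fork_exec) auto
    with True show ?thesis by (simp add: binary_value_Cons)
  next
    case False
    let ?p = "length w + of_bool (binary_value w > 0)"
    have r: "reads (t(h := s)) (h + 1) w" for s
      using Cons.prems by (simp add: reads_upd)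
    have "instrs (counter_tm M) (2, t h) = {(2, Bit False, GoRight), (2, Bit True, GoRight)}"
      using Cons.prems False by (simp add: instrs_counter_Bit counter_def)
    moreover have "counter_tree M (exec t h (2, Bit c, GoRight)) (2 ^ length w) ?p
        (Suc (Suc (length w)))" for c
      unfolding exec.simps offset.simps by (rule Cons.IH[OF r])
    ultimately have "counter_tree M (2, t, h) (2 ^ length w + 2 ^ length w) (Suc ?p)
        (Suc (Suc (Suc (length w))))"
      by (intro uniform_tree_fork_exec) auto
    with False show ?thesis by (simp add: binary_value_Cons mult_2)
  qed
qed

text \<open>Digits 0 split off paths in state 2 and leave a single path in state 1. At the second 1
  only this path turns the half that others reject into a comparison, which adds the value of the
  remaining word exactly once.\<close>

lemma counter_lead:
  assumes "reads t h w"
  shows "counter_tree M (1, t, h) (2 ^ length w + binary_value w)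
    (length w + of_bool (binary_value w > 0)) (Suc (Suc (length w)))"
  using assms
proof (induction w arbitrary: t h)
  case Nil
  from counter_leaf[OF this, of 1 M 1] show ?case by (simp add: binary_value_Nil)
next
  case (Cons b w)
  show ?case
  proof (cases b)
    case True
    have "instrs (counter_tm M) (1, t h) = {(3, Bit True, Stay), (5, Bit True, Stay)}"
      using Cons.prems True by (simp add: instrs_counter_Bit counter_def)
    moreover have "t(h := Bit True) = t"
      using Cons.prems True by (intro fun_upd_idem) simp
    ultimately have "counter_tree M (1, t, h) (2 ^ length (b # w) + binary_value (b # w))
        (Suc (length (b # w))) (Suc (Suc (length (b # w))))"
      using counter_all[OF Cons.prems] counter_compare[OF Cons.prems]
      by (intro uniform_tree_fork_exec) auto
    with True show ?thesis by (simp add: binary_value_Cons)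
  next
    case False
    let ?p = "length w + of_bool (binary_value w > 0)"
    have r: "reads (t(h := s)) (h + 1) w" for s
      using Cons.prems by (simp add: reads_upd)
    have IH: "counter_tree M (1, t(h := s), h + 1) (2 ^ length w + binary_value w) ?p
        (Suc (Suc (length w)))" for s
      by (rule Cons.IH[OF r])
    have "instrs (counter_tm M) (1, t h) = {(1, Bit False, GoRight), (2, Bit False, GoRight)}"
      using Cons.prems False by (simp add: instrs_counter_Bit counter_def)
    then have "counter_tree M (1, t, h) ((2 ^ length w + binary_value w) + 2 ^ length w) (Suc ?p)
        (Suc (Suc (Suc (length w))))"
      using counter_other[OF r] IH by (intro uniform_tree_fork_exec) auto
    with False show ?thesis by (simp add: binary_value_Cons mult_2 ac_simps)
  qed
qed

text \<open>Leading zeros cost steps but no choices, so \<open>p\<close> depends on the value of the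
  numeral and not on its length.\<close>

lemma counter_skip:
  assumes "reads t h w"
  shows "\<exists>p. counter_tree M (0, t, h) (binary_value w) p (Suc (Suc (length w))) \<and>
    (binary_value w = 0 \<or> 2 ^ p < 2 * binary_value w)"
  using assms
proof (induction w arbitrary: t h)
  case Nil
  from counter_leaf[OF this, of 0 M 1] show ?case by (auto simp: binary_value_Nil)
next
  case (Cons b w)
  have r: "reads (t(h := s)) (h + 1) w" for s
    using Cons.prems by (simp add: reads_upd)
  have I: "instrs (counter_tm M) (0, t h) = {(of_bool b, Bit b, GoRight)}"
    using Cons.prems by (simp add: instrs_counter_Bit counter_def)
  show ?case
  proof (cases b)
    case True
    let ?p = "length w + of_bool (binary_value w > 0)"
    have "counter_tree M (0, t, h) (2 ^ length w + binary_value w) ?p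
        (Suc (Suc (Suc (length w))))"
      using I counter_lead[OF r] True by (intro uniform_tree_step_exec) auto
    \<comment> \<open>If the rest has value 0, the postponed choice is never made and the left side
      is only \<open>2 ^ length w\<close>; otherwise that positive value makes the inequality
      strict.\<close>
    moreover have "(2 :: nat) ^ ?p < 2 * (2 ^ length w + binary_value w)"
      by simp
    ultimately show ?thesis using True by (auto simp: binary_value_Cons)
  next
    case False
    obtain p where p: "counter_tree M (0, t(h := Bit b), h + 1) (binary_value w) p (Suc (Suc (length w)))"
      "binary_value w = 0 \<or> 2 ^ p < 2 * binary_value w"
      using Cons.IH[OF r] by blast
    have "instrs (counter_tm M) (0, t h) = {(0, Bit b, GoRight)}" using I False by simp
    moreover have "counter_tree M (exec t h (0, Bit b, GoRight)) (binary_value w) p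
        (Suc (Suc (length w)))"
      using p(1) by (simp only: exec.simps offset.simps)
    ultimately have "counter_tree M (0, t, h) (binary_value w) p (Suc (Suc (Suc (length w))))"
      by (rule uniform_tree_step_exec)
    with p(2) False show ?thesis by (auto simp: binary_value_Cons)
  qed
qed

section \<open>Running the counter on the output of a machine\<close>

lemma counter_tm_tree:
  assumes wf: "wf_tm M" and det: "\<And>k. card (instrs M k) \<le> 1"
    and "depth_le (successors M) (q, t, h) k" "q \<in> states M" "range t \<subseteq> alphabet M"
    and "finite {i. t i \<noteq> Blank}" "card {i. t i \<noteq> Blank} \<le> b"
    and "\<And>\<pi>. \<pi> \<in> halting_runs (successors M) (q, t, h) \<Longrightarrow>
      \<exists>w. outputs (last \<pi>) w \<and> binary_value w = m"
  shows "\<exists>p. counter_tree M (shift 6 (q, t, h)) m p (2 * k + b + 3) \<and> (m = 0 \<or> 2 ^ p < 2 * m)"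
  \<comment> \<open>Each step of \<open>M\<close> costs one unit of time and may fill one cell, that
    is, lengthen the output by one: hence \<open>2 * k + b\<close>. The 3 is the hand-over plus the
    overhead of \<open>counter_skip\<close>. The alphabet condition on the tape guarantees that the
    hand-over applies.\<close>
  using assms(3-)
proof (induction k arbitrary: q t h b)
  case 0
  then show ?case by (simp add: not_depth_le_0)
next
  case (Suc k)
  show ?case
  proof (cases "instrs M (q, t h) = {}")
    case True
    then have "halting_runs (successors M) (q, t, h) = {[(q, t, h)]}"
      by (intro halting_runs_leaf) (simp only: successors_exec image_empty)
    then have "\<exists>w. outputs (last [(q, t, h)]) w \<and> binary_value w = m"
      by (intro Suc.prems(6)) (simp only: insertI1)
    then obtain w where w: "reads t h w" "binary_value w = m"
      unfolding last_ConsL[OF refl] outputs_reads by blast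
    obtain p where p: "counter_tree M (0, t, h) m p (Suc (Suc (length w)))"
      "m = 0 \<or> 2 ^ p < 2 * m"
      using counter_skip[OF w(1)] w(2) by blast
    have "successors (counter_tm M) (shift 6 (q, t, h)) = {(0, t, h)}"
      using True Suc.prems(2,3) by (auto simp: successors_shift instrs_counter_shift)
    then have "counter_tree M (shift 6 (q, t, h)) m p (Suc (Suc (Suc (length w))))"
      using p(1) by (rule uniform_tree.step)
    \<comment> \<open>The output length is known only on halting; it is replaced by the bound fixed
      in advance.\<close>
    then have "counter_tree M (shift 6 (q, t, h)) m p (2 * Suc k + b + 3)"
      using reads_length_le[OF w(1) Suc.prems(4)] Suc.prems(5) by (elim uniform_tree_mono) simp
    with p(2) show ?thesis by blast
  next
    case False
    then have "card (instrs M (q, t h)) = 1"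
      using det[of "(q, t h)"] finite_instrs[OF wf, of "(q, t h)"]
      by (simp add: le_Suc_eq)
    then obtain q' s d where i: "instrs M (q, t h) = {(q', s, d)}"
      by (auto simp: card_1_singleton_iff)
    let ?t = "t(h := s)" and ?h = "h + offset d"
    have S: "successors M (q, t, h) = {(q', ?t, ?h)}"
      by (simp add: successors_exec i del: successors.simps)
    have q's: "q' \<in> states M" "s \<in> alphabet M"
      using wf i unfolding wf_tm_iff by force+
    have sub: "{i. ?t i \<noteq> Blank} \<subseteq> insert h {i. t i \<noteq> Blank}" by auto
    have "card {i. ?t i \<noteq> Blank} \<le> card (insert h {i. t i \<noteq> Blank})"
      using Suc.prems(4) sub by (intro card_mono) auto
    also have "\<dots> \<le> Suc b"
      using Suc.prems(4,5) by (simp add: card_insert_if)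
    finally have card: "card {i. ?t i \<noteq> Blank} \<le> Suc b" .
    have "\<exists>w. outputs (last \<pi>) w \<and> binary_value w = m"
      if "\<pi> \<in> halting_runs (successors M) (q', ?t, ?h)" for \<pi>
    proof -
      have "\<pi> \<noteq> []" using that by (simp add: halting_runs_def runs_from_def)
      moreover have "(q, t, h) # \<pi> \<in> halting_runs (successors M) (q, t, h)"
        using that by (subst halting_runs_step) (simp_all add: S del: successors.simps)
      ultimately show ?thesis
        using Suc.prems(6)[of "(q, t, h) # \<pi>"] by (simp only: last.simps if_False)
    qed
    moreover have "range ?t \<subseteq> alphabet M" using Suc.prems(3) q's(2) by auto
    moreover have "depth_le (successors M) (q', ?t, ?h) k"
      using Suc.prems(1) by (simp add: depth_le_Suc S del: successors.simps)
    moreover have "finite {i. ?t i \<noteq> Blank}"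
      by (rule finite_subset[OF sub]) (simp only: finite_insert Suc.prems(4))
    ultimately obtain p where p: "counter_tree M (shift 6 (q', ?t, ?h)) m p (2 * k + Suc b + 3)"
      "m = 0 \<or> 2 ^ p < 2 * m"
      using Suc.IH[of q' ?t ?h "Suc b"] card q's(1) by blast
    have "successors (counter_tm M) (shift 6 (q, t, h)) = {shift 6 (q', ?t, ?h)}"
      by (simp add: successors_shift instrs_counter_shift i exec_shift del: exec.simps) simp
    then have "counter_tree M (shift 6 (q, t, h)) m p (Suc (2 * k + Suc b + 3))"
      using p(1) by (rule uniform_tree.step)
    with p(2) show ?thesis by (auto simp: add_ac)
  qed
qed

lemma wf_counter_tm:
  assumes "wf_tm M"
  shows "wf_tm (counter_tm M)"
proof -
  have bits: "Bit b \<in> alphabet M" for b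
    using assms by (cases b) (auto simp: wf_tm_def)
  have "fst k \<in> states (counter_tm M) \<and> snd k \<in> alphabet M \<and>
      fst a \<in> states (counter_tm M) \<and> fst (snd a) \<in> alphabet M"
    if "a \<in> instrs (counter_tm M) k" for k a
    using that unfolding instrs_counter_tm
  proof (elim disjE exE conjE)
    fix b assume "snd k = Bit b" "a \<in> counter (fst k) b"
    then show ?thesis
      using bits by (auto simp: counter_def counter_tm_def split: if_splits)
  next
    fix k' a' assume *: "k = shift 6 k'" "a = shift 6 a'" "a' \<in> instrs M k'"
    then have "fst k' \<in> states M \<and> snd k' \<in> alphabet M \<and> fst a' \<in> states M \<and>
        fst (snd a') \<in> alphabet M"
      using assms unfolding wf_tm_iff by blast
    then show ?thesis by (auto simp: * counter_tm_def shift_def)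
  next
    fix k' assume "k = shift 6 k'" "a = (0, snd k', Stay)" "fst k' \<in> states M" "snd k' \<in> alphabet M"
    then show ?thesis by (auto simp: counter_tm_def shift_def)
  qed
  with assms show ?thesis
    unfolding wf_tm_iff by (auto simp: counter_tm_def)
qed

lemma card_instrs_counter_tm:
  assumes wf: "wf_tm M" and det: "\<And>k. card (instrs M k) \<le> 1"
  shows "card (instrs (counter_tm M) k) \<le> 2"
proof (cases "fst k < 6")
  case True
  then have k: "k \<noteq> shift 6 k'" for k'
    using less_6_neq_shift[of "fst k" "snd k" k'] by simp
  have card: "card (counter q b) \<le> 2" for q b
    by (simp add: counter_def card_insert_if)
  have "instrs (counter_tm M) k = {a. \<exists>b. snd k = Bit b \<and> a \<in> counter (fst k) b}"
    using k by (intro set_eqI) (simp add: instrs_counter_tm del: split_paired_Ex)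
  also have "card \<dots> \<le> 2"
    using card by (cases "snd k") simp_all
  finally show ?thesis .
next
  case False
  then have k: "k = shift 6 (fst k - 6, snd k)"
    by (simp add: shift_def prod_eq_iff)
  show ?thesis
    using card_image_le[OF finite_instrs[OF wf], of "shift 6" "(fst k - 6, snd k)"]
      det[of "(fst k - 6, snd k)"]
    by (subst k) (simp add: instrs_counter_shift)
qed

lemma FP_subset_sharpRP1: "FP \<subseteq> sharpRP1"
proof
  fix f assume f: "f \<in> FP"
  then obtain M where M: "dptm M"
    and out: "\<And>x \<pi>. \<pi> \<in> paths M x \<Longrightarrow> \<exists>w. outputs (last \<pi>) w \<and> binary_value w = f x"
    unfolding FP_def poly_time_computable_def by blast
  have wf: "wf_tm M" and det: "\<And>k. card (instrs M k) \<le> 1"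
    using M unfolding dptm_iff by blast+
  obtain r :: "nat poly"
    where r: "\<And>x. depth_le (successors M) (initial M x) (poly r (length x))"
    using M by (auto simp: dptm_iff poly_time_eq)
  have "\<exists>p. counter_tree M (initial (counter_tm M) x) (f x) p (2 * poly r (length x) + length x + 3) \<and>
      (f x = 0 \<or> 2 ^ p < 2 * f x)" for x
  proof -
    obtain t where init: "initial M x = (start M, t, 0)"
      and t: "t = (\<lambda>i. if 0 \<le> i \<and> i < int (length x) then Bit (x ! nat i) else Blank)"
      by (simp add: initial_def)
    have sub: "{i. t i \<noteq> Blank} \<subseteq> {0..<int (length x)}" by (auto simp: t)
    then have "card {i. t i \<noteq> Blank} \<le> length x"
      using card_mono[OF _ sub] by simp
    moreover have "finite {i. t i \<noteq> Blank}" using sub by (rule finite_subset) simp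
    moreover have "Bit b \<in> alphabet M" for b using wf by (cases b) (auto simp: wf_tm_def)
    then have "range t \<subseteq> alphabet M" using wf by (auto simp: t wf_tm_def)
    moreover have "start M \<in> states M" using wf by (simp add: wf_tm_def)
    moreover have "initial (counter_tm M) x = shift 6 (start M, t, 0)"
      by (simp add: initial_def counter_tm_def shift_def t)
    ultimately show ?thesis
      using counter_tm_tree[OF wf det, of "start M" t 0 "poly r (length x)" "length x" "f x"]
        r[of x] out[of _ x] unfolding paths_eq init by simp
  qed
  \<comment> \<open>The number of choices follows the value \<open>f x\<close>, so it is picked for
    each input, as \<open>MR\<close> permits.\<close>
  then obtain p where p: "\<And>x. counter_tree M (initial (counter_tm M) x) (f x) (p x)
      (2 * poly r (length x) + length x + 3)" "\<And>x. f x = 0 \<or> 2 ^ p x < 2 * f x"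
    by metis
  note tree = uniform_tree_sound[OF p(1)]
  have acc: "acc (counter_tm M) x = f x" for x
    using tree[of x] by (simp add: acc_eq)
  have "poly_time (counter_tm M)"
    unfolding poly_time_eq
  proof (intro exI allI)
    fix x :: "bool list"
    \<comment> \<open>The linear term X stems from the at most \<open>length x\<close> nonblank
      cells of the initial tape.\<close>
    have "poly ([:2:] * r + [:3, 1:]) (length x) = 2 * poly r (length x) + length x + 3" by simp
    then show "depth_le (successors (counter_tm M)) (initial (counter_tm M) x)
        (poly ([:2:] * r + [:3, 1:]) (length x))"
      using tree[of x] by (simp only:)
  qed
  then have "nptm (counter_tm M)"
    using wf_counter_tm[OF wf] card_instrs_counter_tm[OF wf det] by (simp add: nptm_iff)
  moreover have "num_choices (counter_tm M) \<pi> = p x" if "\<pi> \<in> paths (counter_tm M) x" for \<pi> x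
    using tree[of x] that by (simp add: num_choices_def paths_eq)
  moreover have "acc (counter_tm M) x = 0 \<or> real (acc (counter_tm M) x) > 1 / 2 * 2 ^ p x" for x
  proof -
    have "real (2 ^ p x) < real (2 * f x)" if "f x \<noteq> 0"
      using p(2)[of x] that by (simp only: of_nat_less_iff) simp
    then show ?thesis by (cases "f x = 0") (simp_all add: acc)
  qed
  ultimately have "counter_tm M \<in> MR" unfolding MR_def by blast
  with f acc show "f \<in> sharpRP1" by (auto simp: FP_def sharpRP1_def intro!: bexI[of _ "counter_tm M"])
qed

theorem theorem9:
  shows "FP \<subseteq> sharpRP1 \<and> sharpRP1 \<subseteq> sharpRP2 \<and> sharpRP2 \<subseteq> sharpP \<and>
         TotP \<subseteq> sharpPE \<and> sharpPE \<subseteq> sharpRP2"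
  using FP_subset_sharpRP1 sharpRP1_subset_sharpRP2 TotP_subset_sharpPE PTIME_subset_RP
  by (auto simp: sharpRP2_def sharpPE_def)

end
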